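(* Let $(X,\tau)$ be a connected topological space, let $A\subseteq X$, and let $\mathcal{I}'_A$ be an ideal associated with $A$ as described in the context. Let $\tau^{*}$ be the topology of the ideal topological space $(X,\tau,\mathcal{I}'_A)$. Then $\tau^{*}$ is connected if and only if $A$ is a preopen set in $\tau$.
   Context: $\tau(x)=\{U\in\tau : x\in U\}$ is the family of open neighbourhoods of $x$; $\operatorname{Int}$, $\operatorname{Cl}$ are taken in $\tau$. A topological space is connected if it is not the union of two nonempty disjoint open subsets. $A$ is preopen if $A\subseteq\operatorname{Int}(\operatorname{Cl}(A))$. An ideal on $X$ is a nonempty family of subsets of $X$ closed under subsets and finite unions; the ideal generated by a family consists of all subsets of finite unions of its members. The ideal $\mathcal{I}'_A$ is generated by $\{U_x\setminus A : x\in A\}$, where $U_x\in\tau(x)$ is chosen for each $x\in A$ as follows: (1) if $x$ has a minimal open neighbourhood, $U_x$ is that neighbourhood; (2) otherwise, if possible, $U_x\in\tau(x)$ is chosen with $U_x\subseteq\operatorname{Int}(\operatorname{Cl}(A))$; (3) otherwise $U_x\in\tau(x)$ is arbitrary. For an ideal $\mathcal{I}$ and $B\subseteq X$, put $B^{*}=\{x\in X : U\cap B\notin\mathcal{I}\text{ for every }U\in\tau(x)\}$; $\tau^{*}$ is the topology with closure operator $\operatorname{Cl}^{*}(B)=B\cup B^{*}$, and $\{V\setminus I : V\in\tau, I\in\mathcal{I}\}$ is a base of it. *)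

theory Defs
  imports "HOL-Analysis.Abstract_Topology"
begin

definition preopen_in :: "'a topology \<Rightarrow> 'a set \<Rightarrow> bool" where
  "preopen_in X A \<longleftrightarrow> A \<subseteq> X interior_of (X closure_of A)"

definition open_nbhds :: "'a topology \<Rightarrow> 'a \<Rightarrow> 'a set set" where
  "open_nbhds X x = {U. openin X U \<and> x \<in> U}"

definition minimal_open_nbhd :: "'a topology \<Rightarrow> 'a \<Rightarrow> 'a set \<Rightarrow> bool" where
  "minimal_open_nbhd X x M \<longleftrightarrow>
     M \<in> open_nbhds X x \<and> (\<forall>V \<in> open_nbhds X x. V \<subseteq> M \<longrightarrow> V = M)"

text \<open>A minimal open neighbourhood is automatically the least one, hence unique.\<close>

lemma minimal_open_nbhd_iff_least:
  "minimal_open_nbhd X x M \<longleftrightarrow>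
     M \<in> open_nbhds X x \<and> (\<forall>V \<in> open_nbhds X x. M \<subseteq> V)"
proof
  assume M: "minimal_open_nbhd X x M"
  have "M \<subseteq> V" if "V \<in> open_nbhds X x" for V
  proof -
    have "M \<inter> V \<in> open_nbhds X x"
      using M that by (auto simp: minimal_open_nbhd_def open_nbhds_def)
    then have "M \<inter> V = M"
      using M unfolding minimal_open_nbhd_def by blast
    then show ?thesis by blast
  qed
  then show "M \<in> open_nbhds X x \<and> (\<forall>V \<in> open_nbhds X x. M \<subseteq> V)"
    using M by (simp add: minimal_open_nbhd_def)
qed (auto simp: minimal_open_nbhd_def)

definition ideal_on :: "'a set \<Rightarrow> 'a set set \<Rightarrow> bool" where
  "ideal_on S \<I> \<longleftrightarrow> \<I> \<noteq> {} \<and> \<I> \<subseteq> Pow S \<and>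
     (\<forall>B \<in> \<I>. \<forall>C. C \<subseteq> B \<longrightarrow> C \<in> \<I>) \<and> (\<forall>B \<in> \<I>. \<forall>C \<in> \<I>. B \<union> C \<in> \<I>)"

text \<open>The finite subfamily may be empty, so the empty family generates the ideal \<open>{{}}\<close>.\<close>

definition generated_ideal :: "'a set set \<Rightarrow> 'a set set" where
  "generated_ideal \<F> = {B. \<exists>\<G>. finite \<G> \<and> \<G> \<subseteq> \<F> \<and> B \<subseteq> \<Union>\<G>}"

lemma ideal_on_generated_ideal:
  assumes "\<F> \<subseteq> Pow S"
  shows "ideal_on S (generated_ideal \<F>)"
proof -
  have emp: "{} \<in> generated_ideal \<F>"
    unfolding generated_ideal_def by blast
  have un: "B \<union> C \<in> generated_ideal \<F>"
    if "B \<in> generated_ideal \<F>" "C \<in> generated_ideal \<F>" for B C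
  proof -
    obtain \<G> \<H> where "finite \<G>" "\<G> \<subseteq> \<F>" "B \<subseteq> \<Union>\<G>" "finite \<H>" "\<H> \<subseteq> \<F>" "C \<subseteq> \<Union>\<H>"
      using \<open>B \<in> generated_ideal \<F>\<close> \<open>C \<in> generated_ideal \<F>\<close>
      unfolding generated_ideal_def by blast
    then have "finite (\<G> \<union> \<H>) \<and> \<G> \<union> \<H> \<subseteq> \<F> \<and> B \<union> C \<subseteq> \<Union>(\<G> \<union> \<H>)"
      by auto
    then show ?thesis unfolding generated_ideal_def by blast
  qed
  have sub: "generated_ideal \<F> \<subseteq> Pow S"
    using assms unfolding generated_ideal_def by blast
  have down: "C \<in> generated_ideal \<F>" if "B \<in> generated_ideal \<F>" "C \<subseteq> B" for B C
    using that unfolding generated_ideal_def by blast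
  show ?thesis
    unfolding ideal_on_def
  proof (intro conjI ballI allI impI)
    show "generated_ideal \<F> \<noteq> {}" using emp by blast
  qed (fact sub, erule (1) down, erule (1) un)
qed

definition local_function :: "'a topology \<Rightarrow> 'a set set \<Rightarrow> 'a set \<Rightarrow> 'a set" where
  "local_function X \<I> B = {x \<in> topspace X. \<forall>U \<in> open_nbhds X x. U \<inter> B \<notin> \<I>}"

definition star_closure :: "'a topology \<Rightarrow> 'a set set \<Rightarrow> 'a set \<Rightarrow> 'a set" where
  "star_closure X \<I> B = B \<union> local_function X \<I> B"

text \<open>The sets whose complement is a fixed point of the closure operator. The lemmas below show
  that for an ideal this is a topology, that its closure operator is the given one, and that the
  sets \<open>V - I\<close> are a base.\<close>

definition star_topology :: "'a topology \<Rightarrow> 'a set set \<Rightarrow> 'a topology" where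
  "star_topology X \<I> = topology (\<lambda>W. W \<subseteq> topspace X \<and>
     star_closure X \<I> (topspace X - W) = topspace X - W)"

lemma star_closed_compl_iff:
  assumes "ideal_on (topspace X) \<I>" "W \<subseteq> topspace X"
  shows "star_closure X \<I> (topspace X - W) = topspace X - W \<longleftrightarrow>
     (\<forall>x \<in> W. \<exists>V I. openin X V \<and> I \<in> \<I> \<and> x \<in> V - I \<and> V - I \<subseteq> W)" (is "?L \<longleftrightarrow> ?R")
proof
  assume ?L
  show ?R
  proof
    fix x assume x: "x \<in> W"
    then have "x \<notin> local_function X \<I> (topspace X - W)"
      using \<open>?L\<close> unfolding star_closure_def by blast
    then obtain V where V: "openin X V" "x \<in> V" "V \<inter> (topspace X - W) \<in> \<I>"
      using x assms(2) unfolding local_function_def open_nbhds_def by blast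
    have "V \<subseteq> topspace X" using V(1) by (rule openin_subset)
    then have "x \<in> V - V \<inter> (topspace X - W) \<and> V - V \<inter> (topspace X - W) \<subseteq> W"
      using V(2) x by blast
    then show "\<exists>V I. openin X V \<and> I \<in> \<I> \<and> x \<in> V - I \<and> V - I \<subseteq> W"
      using V by blast
  qed
next
  assume R: ?R
  have "x \<notin> W" if x: "x \<in> local_function X \<I> (topspace X - W)" for x
  proof
    assume "x \<in> W"
    then obtain V I where V: "openin X V" "I \<in> \<I>" "x \<in> V - I" "V - I \<subseteq> W"
      using R by blast
    then have "V \<inter> (topspace X - W) \<subseteq> I" by blast
    then have "V \<inter> (topspace X - W) \<in> \<I>"
      using assms(1) V(2) unfolding ideal_on_def by blast
    then show False
      using x V unfolding local_function_def open_nbhds_def by blast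
  qed
  then show ?L
    unfolding star_closure_def local_function_def by blast
qed

lemma openin_star_topology_base:
  assumes "ideal_on (topspace X) \<I>"
  shows "openin (star_topology X \<I>) W \<longleftrightarrow> W \<subseteq> topspace X \<and>
     (\<forall>x \<in> W. \<exists>V I. openin X V \<and> I \<in> \<I> \<and> x \<in> V - I \<and> V - I \<subseteq> W)"
proof -
  let ?P = "\<lambda>W. W \<subseteq> topspace X \<and>
     (\<forall>x \<in> W. \<exists>V I. openin X V \<and> I \<in> \<I> \<and> x \<in> V - I \<and> V - I \<subseteq> W)"
  have eq: "(\<lambda>W. W \<subseteq> topspace X \<and> star_closure X \<I> (topspace X - W) = topspace X - W) = ?P"
    by (intro ext conj_cong refl star_closed_compl_iff[OF assms])
  have "istopology ?P"
    unfolding istopology_def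
  proof (intro conjI allI impI)
    fix S T assume S: "?P S" and T: "?P T"
    show "S \<inter> T \<subseteq> topspace X" using S by blast
    show "\<forall>x \<in> S \<inter> T. \<exists>V I. openin X V \<and> I \<in> \<I> \<and> x \<in> V - I \<and> V - I \<subseteq> S \<inter> T"
    proof
      fix x assume "x \<in> S \<inter> T"
      then obtain V I V' I' where
        *: "openin X V" "I \<in> \<I>" "x \<in> V - I" "V - I \<subseteq> S"
           "openin X V'" "I' \<in> \<I>" "x \<in> V' - I'" "V' - I' \<subseteq> T"
        using S T by blast
      have "openin X (V \<inter> V')" "I \<union> I' \<in> \<I>"
        using * assms unfolding ideal_on_def by auto
      moreover have "x \<in> (V \<inter> V') - (I \<union> I') \<and> (V \<inter> V') - (I \<union> I') \<subseteq> S \<inter> T"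
        using * by blast
      ultimately show "\<exists>V I. openin X V \<and> I \<in> \<I> \<and> x \<in> V - I \<and> V - I \<subseteq> S \<inter> T"
        by blast
    qed
  next
    fix \<K> assume K: "\<forall>K\<in>\<K>. ?P K"
    show "\<Union>\<K> \<subseteq> topspace X" using K by blast
    show "\<forall>x \<in> \<Union>\<K>. \<exists>V I. openin X V \<and> I \<in> \<I> \<and> x \<in> V - I \<and> V - I \<subseteq> \<Union>\<K>"
    proof
      fix x assume "x \<in> \<Union>\<K>"
      then obtain K where K_in: "K \<in> \<K>" "x \<in> K" by blast
      then have "?P K" using K by blast
      then obtain V I where "openin X V" "I \<in> \<I>" "x \<in> V - I" "V - I \<subseteq> K"
        using \<open>x \<in> K\<close> by blast
      moreover have "K \<subseteq> \<Union>\<K>" using K_in(1) by blast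
      ultimately show "\<exists>V I. openin X V \<and> I \<in> \<I> \<and> x \<in> V - I \<and> V - I \<subseteq> \<Union>\<K>"
        by (meson order_trans)
    qed
  qed
  then show ?thesis
    unfolding star_topology_def eq by (simp add: topology_inverse')
qed

lemma topspace_star_topology:
  assumes "ideal_on (topspace X) \<I>"
  shows "topspace (star_topology X \<I>) = topspace X"
proof
  show "topspace (star_topology X \<I>) \<subseteq> topspace X"
    using openin_star_topology_base[OF assms] openin_topspace by blast
  have "{} \<in> \<I>" using assms unfolding ideal_on_def by blast
  then have "openin (star_topology X \<I>) (topspace X)"
    unfolding openin_star_topology_base[OF assms]
    by (metis Diff_empty openin_topspace order_refl)
  then show "topspace X \<subseteq> topspace (star_topology X \<I>)"
    by (rule openin_subset)
qed

lemma closure_of_star_topology: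
  assumes "ideal_on (topspace X) \<I>" "B \<subseteq> topspace X"
  shows "star_topology X \<I> closure_of B = star_closure X \<I> B"
proof -
  have sub: "C \<in> \<I>" if "D \<in> \<I>" "C \<subseteq> D" for C D
    using that assms(1) unfolding ideal_on_def by blast
  have "x \<in> star_closure X \<I> B \<longleftrightarrow>
      (\<forall>W. x \<in> W \<and> openin (star_topology X \<I>) W \<longrightarrow> (\<exists>y \<in> B. y \<in> W))"
    if x: "x \<in> topspace X" for x
  proof
    assume L: "x \<in> star_closure X \<I> B"
    show "\<forall>W. x \<in> W \<and> openin (star_topology X \<I>) W \<longrightarrow> (\<exists>y \<in> B. y \<in> W)"
    proof (intro allI impI, elim conjE)
      fix W assume "x \<in> W" "openin (star_topology X \<I>) W"
      then obtain V I where V: "openin X V" "I \<in> \<I>" "x \<in> V - I" "V - I \<subseteq> W"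
        unfolding openin_star_topology_base[OF assms(1)] by blast
      show "\<exists>y \<in> B. y \<in> W"
      proof (cases "x \<in> B")
        case False
        then have "V \<inter> B \<notin> \<I>"
          using L V unfolding star_closure_def local_function_def open_nbhds_def by blast
        then have "\<not> V \<inter> B \<subseteq> I" using sub V(2) by blast
        then show ?thesis using V(4) by blast
      qed (use \<open>x \<in> W\<close> in blast)
    qed
  next
    assume R: "\<forall>W. x \<in> W \<and> openin (star_topology X \<I>) W \<longrightarrow> (\<exists>y \<in> B. y \<in> W)"
    show "x \<in> star_closure X \<I> B"
    proof (rule ccontr)
      assume n: "x \<notin> star_closure X \<I> B"
      then obtain V where V: "openin X V" "x \<in> V" "V \<inter> B \<in> \<I>"
        using x unfolding star_closure_def local_function_def open_nbhds_def by blast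
      have "openin (star_topology X \<I>) (V - V \<inter> B)"
        unfolding openin_star_topology_base[OF assms(1)]
        using V openin_subset[OF V(1)] by blast
      moreover have "x \<in> V - V \<inter> B"
        using V n unfolding star_closure_def by blast
      ultimately have "\<exists>y \<in> B. y \<in> V - V \<inter> B"
        using R[rule_format, of "V - V \<inter> B"] by simp
      then show False using V(2) by auto
    qed
  qed
  moreover have "star_closure X \<I> B \<subseteq> topspace X"
    using assms(2) unfolding star_closure_def local_function_def by blast
  ultimately show ?thesis
    unfolding closure_of_def topspace_star_topology[OF assms(1)] by blast
qed

definition admissible_nbhds :: "'a topology \<Rightarrow> 'a set \<Rightarrow> ('a \<Rightarrow> 'a set) \<Rightarrow> bool" where
  "admissible_nbhds X A U \<longleftrightarrow>
     (\<forall>x \<in> A. U x \<in> open_nbhds X x \<and>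
       (if \<exists>M. minimal_open_nbhd X x M then minimal_open_nbhd X x (U x)
        else if \<exists>V \<in> open_nbhds X x. V \<subseteq> X interior_of (X closure_of A)
        then U x \<subseteq> X interior_of (X closure_of A)
        else True))"

definition associated_ideal :: "'a set \<Rightarrow> ('a \<Rightarrow> 'a set) \<Rightarrow> 'a set set" where
  "associated_ideal A U = generated_ideal {U x - A | x. x \<in> A}"

lemma ideal_on_associated_ideal:
  assumes "admissible_nbhds X A U"
  shows "ideal_on (topspace X) (associated_ideal A U)"
proof -
  have "U x \<subseteq> topspace X" if "x \<in> A" for x
    using assms that openin_subset unfolding admissible_nbhds_def open_nbhds_def by blast
  then show ?thesis
    unfolding associated_ideal_def by (intro ideal_on_generated_ideal) blast
qed

end

theory Submission imports Defs begin

text \<open>A \<open>\<tau>\<close>-open member of an ideal is \<open>\<tau>\<^sup>*\<close>-clopen; conversely, if the only \<open>\<tau>\<close>-open member is the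
  empty set, then \<open>\<tau>\<^sup>*\<close> inherits connectedness from \<open>\<tau>\<close>, because a separation by \<open>\<tau>\<^sup>*\<close>-open sets
  extends to a cover by two \<open>\<tau>\<close>-open sets whose overlap lies locally in the ideal. If some
  \<open>x \<in> A\<close> is not in \<open>Int (Cl A)\<close>, then \<open>U\<^sub>x - Cl A\<close> is a nonempty open member of the
  ideal. If \<open>A\<close> is preopen, all \<open>U\<^sub>x\<close> lie in \<open>Int (Cl A)\<close>, where \<open>A\<close> is dense, so members of the
  ideal have empty interior.\<close>

lemma openin_star_topology_Diff:
  assumes "ideal_on (topspace X) \<I>" "openin X V" "I \<in> \<I>"
  shows "openin (star_topology X \<I>) (V - I)"
  unfolding openin_star_topology_base[OF assms(1)]
proof (intro conjI ballI)
  show "V - I \<subseteq> topspace X"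
    using openin_subset[OF assms(2)] by blast
  show "\<exists>V' I'. openin X V' \<and> I' \<in> \<I> \<and> x \<in> V' - I' \<and> V' - I' \<subseteq> V - I" if "x \<in> V - I" for x
    using assms(2,3) that by (intro exI[of _ V] exI[of _ I]) simp
qed

lemma openin_star_topology_openin:
  assumes "ideal_on (topspace X) \<I>" "openin X V"
  shows "openin (star_topology X \<I>) V"
proof -
  have "{} \<in> \<I>" using assms(1) unfolding ideal_on_def by blast
  then show ?thesis
    using openin_star_topology_Diff[OF assms] by force
qed

lemma open_ideal_member_trivial_if_star_connected:
  assumes I: "ideal_on (topspace X) \<I>" and conn: "connected_space (star_topology X \<I>)"
    and W: "openin X W" "W \<in> \<I>"
  shows "W = {} \<or> W = topspace X"
proof -
  \<comment> \<open>The complement of \<open>W\<close> is itself a base set \<open>V - I\<close>,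
    with \<open>V = topspace X\<close> and \<open>I = W\<close>.\<close>
  have "openin (star_topology X \<I>) (topspace (star_topology X \<I>) - W)"
    using openin_star_topology_Diff[OF I openin_topspace W(2)]
    by (simp add: topspace_star_topology[OF I])
  moreover have op: "openin (star_topology X \<I>) W"
    by (rule openin_star_topology_openin[OF I W(1)])
  ultimately have "closedin (star_topology X \<I>) W"
    using openin_subset by (auto simp: closedin_def)
  then show ?thesis
    using conn op unfolding connected_space_clopen_in by (metis topspace_star_topology[OF I])
qed

lemma connected_space_star_topology:
  assumes I: "ideal_on (topspace X) \<I>" and conn: "connected_space X"
    and codense: "\<And>W. openin X W \<Longrightarrow> W \<in> \<I> \<Longrightarrow> W = {}"
  shows "connected_space (star_topology X \<I>)"
  unfolding connected_space_def topspace_star_topology[OF I]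
proof (intro notI, elim exE conjE)
  fix E F
  assume E: "openin (star_topology X \<I>) E" "E \<noteq> {}"
    and F: "openin (star_topology X \<I>) F" "F \<noteq> {}"
    and cover: "topspace X \<subseteq> E \<union> F" and disj: "E \<inter> F = {}"
  \<comment> \<open>\<open>env S\<close> collects the open sets contained in \<open>S\<close> up to
    a member of the ideal; it turns a star-open set into a \<open>\<tau>\<close>-open
    superset.\<close>
  define env where "env S = \<Union>{V. openin X V \<and> (\<exists>I\<in>\<I>. V - I \<subseteq> S)}" for S
  have op: "openin X (env S)" for S
    unfolding env_def by blast
  have sub: "S \<subseteq> env S" if "openin (star_topology X \<I>) S" for S
    using that unfolding openin_star_topology_base[OF I] env_def by blast
  have "env E \<noteq> {}" "env F \<noteq> {}" "topspace X \<subseteq> env E \<union> env F"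
    using sub[OF E(1)] sub[OF F(1)] E(2) F(2) cover by auto
  then have "env E \<inter> env F \<noteq> {}"
    using conn op[of E] op[of F] unfolding connected_space_def by blast
  then obtain z V I V' I'
    where V: "openin X V" "I \<in> \<I>" "V - I \<subseteq> E" "z \<in> V"
      and V': "openin X V'" "I' \<in> \<I>" "V' - I' \<subseteq> F" "z \<in> V'"
    unfolding env_def by blast
  \<comment> \<open>A point of \<open>V \<inter> V'\<close> outside both \<open>I\<close> and
    \<open>I'\<close> would lie in \<open>E \<inter> F\<close>.\<close>
  have "V \<inter> V' \<subseteq> I \<union> I'"
    using V(3) V'(3) disj by blast
  moreover have "I \<union> I' \<in> \<I>"
    using I V(2) V'(2) unfolding ideal_on_def by blast
  ultimately have "V \<inter> V' \<in> \<I>"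
    using I unfolding ideal_on_def by blast
  then show False
    using codense[of "V \<inter> V'"] V(1,4) V'(1,4) by blast
qed

text \<open>Since \<open>Int (Cl A)\<close> is an open neighbourhood of \<open>x\<close>, it
  contains the minimal one if that exists, and otherwise witnesses that the second choice is
  possible; the arbitrary choice never occurs.\<close>

lemma admissible_nbhd_subset:
  assumes "preopen_in X A" "admissible_nbhds X A U" "x \<in> A"
  shows "U x \<subseteq> X interior_of (X closure_of A)"
proof -
  let ?G = "X interior_of (X closure_of A)"
  have "?G \<in> open_nbhds X x"
    using assms(1,3) unfolding preopen_in_def open_nbhds_def by auto
  moreover from this have "U x \<subseteq> ?G" if "minimal_open_nbhd X x (U x)"
    using that unfolding minimal_open_nbhd_iff_least by blast
  ultimately show ?thesis
    using bspec[OF assms(2)[unfolded admissible_nbhds_def] assms(3)] by (auto split: if_splits)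
qed

lemma generated_ideal_subset_member:
  assumes "F \<in> \<F>" "B \<subseteq> F"
  shows "B \<in> generated_ideal \<F>"
  using assms unfolding generated_ideal_def
  by (intro CollectI exI[of _ "{F}"]) auto

lemma generated_ideal_member_subset_Union:
  assumes "B \<in> generated_ideal \<F>"
  shows "B \<subseteq> \<Union>\<F>"
proof -
  obtain \<G> where "\<G> \<subseteq> \<F>" "B \<subseteq> \<Union>\<G>"
    using assms unfolding generated_ideal_def by auto
  then show ?thesis
    using Union_mono[of \<G> \<F>] by (meson order_trans)
qed

lemma open_associated_ideal_member_empty:
  assumes "preopen_in X A" "admissible_nbhds X A U"
    and W: "openin X W" "W \<in> associated_ideal A U"
  shows "W = {}"
proof -
  have "W \<subseteq> \<Union>{U x - A | x. x \<in> A}"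
    using W(2) unfolding associated_ideal_def by (rule generated_ideal_member_subset_Union)
  also have "\<dots> \<subseteq> X interior_of (X closure_of A) - A"
  proof (rule Union_least)
    fix B assume "B \<in> {U x - A | x. x \<in> A}"
    then obtain x where "x \<in> A" "B = U x - A"
      by auto
    then show "B \<subseteq> X interior_of (X closure_of A) - A"
      using admissible_nbhd_subset[OF assms(1,2)] by (simp add: Diff_mono)
  qed
  finally have "W \<subseteq> X interior_of (X closure_of A) - A" .
  then have "W \<subseteq> X closure_of A" "W \<inter> A = {}"
    using interior_of_subset[of X "X closure_of A"] by auto
  \<comment> \<open>An open set missing \<open>A\<close> also misses its closure, yet
    \<open>W\<close> lies in that closure.\<close>
  then show ?thesis
    using openin_Int_closure_of_eq_empty[OF W(1), of A] by (simp add: Int_absorb2)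
qed

theorem theorem3:
  fixes X :: "'a topology" and A :: "'a set" and U :: "'a \<Rightarrow> 'a set"
  assumes "connected_space X"
    and "A \<subseteq> topspace X"
    and "admissible_nbhds X A U"
  shows "connected_space (star_topology X (associated_ideal A U)) \<longleftrightarrow> preopen_in X A"
proof
  note I = ideal_on_associated_ideal[OF assms(3)]
  show "connected_space (star_topology X (associated_ideal A U))" if "preopen_in X A"
    using connected_space_star_topology[OF I assms(1)]
      open_associated_ideal_member_empty[OF that assms(3)] by blast
  assume conn: "connected_space (star_topology X (associated_ideal A U))"
  have AC: "A \<subseteq> X closure_of A"
    using assms(2) by (rule closure_of_subset)
  show "preopen_in X A"
    unfolding preopen_in_def
  proof
    fix x assume x: "x \<in> A"
    \<comment> \<open>Removing the closure instead of \<open>A\<close> makes \<open>?W\<close> open,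
      while \<open>A \<subseteq> Cl A\<close> keeps it inside the generator
      \<open>U x - A\<close>.\<close>
    let ?W = "U x - X closure_of A"
    have Ux: "openin X (U x)" "x \<in> U x"
      using assms(3) x unfolding admissible_nbhds_def open_nbhds_def by auto
    have "openin X ?W"
      using Ux(1) by (simp add: openin_diff)
    moreover have "?W \<in> associated_ideal A U"
      unfolding associated_ideal_def
      by (rule generated_ideal_subset_member[of "U x - A"]) (use x AC in auto)
    \<comment> \<open>The point \<open>x\<close> is in the space but not in \<open>?W\<close>, which
      leaves only the empty alternative.\<close>
    moreover have "?W \<noteq> topspace X"
      using x AC assms(2) by blast
    ultimately have "?W = {}"
      using open_ideal_member_trivial_if_star_connected[OF I conn] by blast
    then have "U x \<subseteq> X interior_of (X closure_of A)"
      using Ux(1) by (intro interior_of_maximal) auto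
    then show "x \<in> X interior_of (X closure_of A)"
      using Ux(2) by blast
  qed
qed

end
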